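(* Let $n\geq 2$ be an integer and let $G_n$ be the metric graph of genus $n+3$ described in the context. Let $r$ be an integer with $1 \leq r \leq n$. Then $G_n$ has no $g^r_{2r+1}$, i.e. there is no divisor $D$ on $G_n$ with $\deg(D)=2r+1$ and $\operatorname{rk}(D)=r$.
   Context: **The graph $G_n$.** $G_0$ is the metric graph of genus 2 having exactly two points $v_1,v_2$ of valence 3 (all other points have valence 2), connected by three edges $e_0,e_1,e_2$ of mutually different finite lengths. For $0\leq i\leq 2$, $m_i$ is the midpoint of $e_i$. Put $q_0=m_0$. Fix a point $q_1$ in the open segment $]v_1,m_1[\subset e_1$ and a point $q_2$ in the open segment $]v_2,m_2[\subset e_2$. For $n\geq 2$ fix further general different points $q_3,\dots,q_n$ on $G_0$ (i.e. $v_1,v_2,m_0,m_1,m_2,q_1,q_2,q_3,\dots,q_n$ are pairwise distinct). $G_n$ is obtained from $G_0$ by attaching, for each $0\leq i\leq n$, a loop $\gamma_i$ (a circle of some finite positive length) at $q_i$. **Divisors.** A divisor on a metric graph $\Gamma$ is a finite formal $\mathbb{Z}$-combination of points of $\Gamma$; it is effective if all coefficients are $\geq 0$. A rational function is a continuous piecewise linear function $\Gamma\to\mathbb{R}$ with integer slopes and finitely many pieces. Its divisor has at each point the coefficient given by the sum of outgoing slopes (up to a global sign convention), and two divisors are linearly equivalent if they differ by the divisor of a rational function. $|D|$ is the set of effective divisors linearly equivalent to $D$. The rank $\operatorname{rk}(D)$ is $-1$ if $|D|=\emptyset$, and otherwise the largest $r\ge 0$ such that $|D-F|\ne\emptyset$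 for every effective $F$ of degree $r$. A $g^r_d$ on $\Gamma$ is a complete linear system $|D|$ with $\deg D=d$ and $\operatorname{rk}(D)=r$. *)

theory Defs
  imports "HOL-Analysis.Analysis" "HOL-Library.Poly_Mapping"
begin

text \<open>
  A metric graph is presented as a finite disjoint union of closed segments, the segment of
  the edge \<open>e\<close> being the interval from \<open>0\<close> to \<open>len e\<close>, in which finitely many points are
  identified with one another.  The gluing is given by the charts: the parameters \<open>t\<close> of \<open>e\<close>
  and \<open>t'\<close> of \<open>e'\<close> describe the same point iff \<open>chart e t = chart e' t'\<close>.  The glued parameters
  need not be end points, so that something can be attached in the interior of an
  edge without subdividing it.  Charts are irrelevant outside their segments.
\<close>

record ('e, 'p) metric_graph =
  edges :: "'e set"
  len :: "'e \<Rightarrow> real"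
  chart :: "'e \<Rightarrow> real \<Rightarrow> 'p"

definition params :: "('e, 'p) metric_graph \<Rightarrow> ('e \<times> real) set" where
  "params G = (SIGMA e:edges G. {0..len G e})"

definition points :: "('e, 'p) metric_graph \<Rightarrow> 'p set" where
  "points G = (\<lambda>(e, t). chart G e t) ` params G"

definition glued_params :: "('e, 'p) metric_graph \<Rightarrow> ('e \<times> real) set" where
  "glued_params G =
     {(e, t) \<in> params G. \<exists>(e', t') \<in> params G. (e', t') \<noteq> (e, t) \<and> chart G e' t' = chart G e t}"

definition is_metric_graph :: "('e, 'p) metric_graph \<Rightarrow> bool" where
  "is_metric_graph G \<longleftrightarrow>
     finite (edges G) \<and> edges G \<noteq> {} \<and> (\<forall>e \<in> edges G. 0 < len G e) \<and>
     finite (glued_params G) \<and>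
     (\<forall>A \<subseteq> edges G. A \<noteq> {} \<and> A \<noteq> edges G \<longrightarrow>
        (\<exists>(e, t) \<in> params G. \<exists>(e', t') \<in> params G.
           e \<in> A \<and> e' \<notin> A \<and> chart G e t = chart G e' t'))"

definition pl_integer_slopes :: "real \<Rightarrow> (real \<Rightarrow> real) \<Rightarrow> bool" where
  "pl_integer_slopes L g \<longleftrightarrow> continuous_on {0..L} g \<and>
     (\<exists>(k :: nat) (t :: nat \<Rightarrow> real) (s :: nat \<Rightarrow> int). t 0 = 0 \<and> t k = L \<and>
        (\<forall>i<k. t i < t (Suc i) \<and>
           (\<forall>x \<in> {t i..t (Suc i)}. g x = g (t i) + of_int (s i) * (x - t i))))"

text \<open>
  A function on the glued space is continuous iff its pullbacks to all segments are.
\<close>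

definition rational_function :: "('e, 'p) metric_graph \<Rightarrow> ('p \<Rightarrow> real) \<Rightarrow> bool" where
  "rational_function G f \<longleftrightarrow> (\<forall>e \<in> edges G. pl_integer_slopes (len G e) (f \<circ> chart G e))"

text \<open>
  The tangent directions at a point \<open>p\<close> are obtained from the parameters \<open>(e, t)\<close> of \<open>p\<close>:
  an increasing direction if \<open>t < len e\<close> and a decreasing one if \<open>0 < t\<close>.
\<close>

definition slope_up :: "(real \<Rightarrow> real) \<Rightarrow> real \<Rightarrow> int" where
  "slope_up g t = (THE s. (g has_real_derivative of_int s) (at_right t))"

definition slope_down :: "(real \<Rightarrow> real) \<Rightarrow> real \<Rightarrow> int" where
  "slope_down g t = (THE s. (g has_real_derivative - of_int s) (at_left t))"

definition ord_at :: "('e, 'p) metric_graph \<Rightarrow> ('p \<Rightarrow> real) \<Rightarrow> 'p \<Rightarrow> int" where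
  "ord_at G f p =
     (\<Sum>(e, t) \<in> {(e, t) \<in> params G. chart G e t = p}.
        (if t < len G e then slope_up (f \<circ> chart G e) t else 0) +
        (if 0 < t then slope_down (f \<circ> chart G e) t else 0))"

definition divisor :: "('e, 'p) metric_graph \<Rightarrow> ('p \<Rightarrow>\<^sub>0 int) \<Rightarrow> bool" where
  "divisor G D \<longleftrightarrow> Poly_Mapping.keys D \<subseteq> points G"

definition effective :: "('p \<Rightarrow>\<^sub>0 int) \<Rightarrow> bool" where
  "effective D \<longleftrightarrow> (\<forall>p. 0 \<le> Poly_Mapping.lookup D p)"

definition div_degree :: "('p \<Rightarrow>\<^sub>0 int) \<Rightarrow> int" where
  "div_degree D = (\<Sum>p \<in> Poly_Mapping.keys D. Poly_Mapping.lookup D p)"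

definition lin_equiv :: "('e, 'p) metric_graph \<Rightarrow> ('p \<Rightarrow>\<^sub>0 int) \<Rightarrow> ('p \<Rightarrow>\<^sub>0 int) \<Rightarrow> bool" where
  "lin_equiv G D E \<longleftrightarrow>
     (\<exists>f. rational_function G f \<and> (\<forall>p. Poly_Mapping.lookup (D - E) p = ord_at G f p))"

definition linear_system :: "('e, 'p) metric_graph \<Rightarrow> ('p \<Rightarrow>\<^sub>0 int) \<Rightarrow> ('p \<Rightarrow>\<^sub>0 int) set" where
  "linear_system G D = {E. divisor G E \<and> effective E \<and> lin_equiv G E D}"

text \<open>
  The \<open>GREATEST\<close> is taken over a set that is bounded by \<open>div_degree D\<close>, since principal
  divisors have degree zero, and that contains \<open>0\<close> when the linear system is nonempty.
\<close>

definition div_rank :: "('e, 'p) metric_graph \<Rightarrow> ('p \<Rightarrow>\<^sub>0 int) \<Rightarrow> int" where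
  "div_rank G D =
     (if linear_system G D = {} then - 1
      else int (GREATEST r. \<forall>F. divisor G F \<and> effective F \<and> div_degree F = int r \<longrightarrow>
                                linear_system G (D - F) \<noteq> {}))"

text \<open>
  The graph with two trivalent points \<open>v1\<close>, \<open>v2\<close> joined by the edges \<open>0, 1, 2\<close>, of lengths
  \<open>l 0, l 1, l 2\<close>.  All edges are parametrised from \<open>v1\<close> to \<open>v2\<close>, and \<open>Inner i t\<close> is the point
  of edge \<open>i\<close> at distance \<open>t\<close> from \<open>v1\<close> along that edge.
\<close>

datatype theta_point = V1 | V2 | Inner nat real

definition theta_graph :: "(nat \<Rightarrow> real) \<Rightarrow> (nat, theta_point) metric_graph" where
  "theta_graph l =
     \<lparr>edges = {..2}, len = l,
      chart = (\<lambda>i t. if t = 0 then V1 else if t = l i then V2 else Inner i t)\<rparr>"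

definition midpt :: "('e, 'p) metric_graph \<Rightarrow> 'e \<Rightarrow> 'p" where
  "midpt G e = chart G e (len G e / 2)"

text \<open>
  For each \<open>i \<in> I\<close> a circle of length \<open>c i\<close> is attached at the point \<open>q i\<close>.
\<close>

definition attach_loops ::
  "('e, 'p) metric_graph \<Rightarrow> 'i set \<Rightarrow> ('i \<Rightarrow> 'p) \<Rightarrow> ('i \<Rightarrow> real) \<Rightarrow>
     ('e + 'i, 'p + 'i \<times> real) metric_graph" where
  "attach_loops G I q c =
     \<lparr>edges = edges G <+> I,
      len = case_sum (len G) c,
      chart = case_sum (\<lambda>e t. Inl (chart G e t))
                (\<lambda>i t. if t = 0 \<or> t = c i then Inl (q i) else Inr (i, t))\<rparr>"

lemma is_metric_graph_theta_graph:
  assumes "\<And>i. i \<le> 2 \<Longrightarrow> 0 < l i"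
  shows "is_metric_graph (theta_graph l)"
proof -
  let ?G = "theta_graph l"
  have "glued_params ?G \<subseteq> {..2} \<times> {0} \<union> (\<lambda>i. (i, l i)) ` {..2}"
    by (auto simp: glued_params_def params_def theta_graph_def split: if_splits)
  then have fin: "finite (glued_params ?G)"
    by (rule finite_subset) auto
  have "\<exists>(e, t) \<in> params ?G. \<exists>(e', t') \<in> params ?G.
           e \<in> A \<and> e' \<notin> A \<and> chart ?G e t = chart ?G e' t'"
    if A: "A \<subseteq> edges ?G" "A \<noteq> {}" "A \<noteq> edges ?G" for A
  proof -
    obtain e e' where e: "e \<in> A" "e \<in> edges ?G" "e' \<in> edges ?G" "e' \<notin> A"
      using A by blast
    moreover have "(e, 0) \<in> params ?G" "(e', 0) \<in> params ?G"
      using e assms by (auto simp: params_def theta_graph_def less_imp_le)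
    moreover have "chart ?G e 0 = chart ?G e' 0"
      by (simp add: theta_graph_def)
    ultimately show ?thesis by blast
  qed
  with fin show ?thesis
    using assms by (auto simp: is_metric_graph_def theta_graph_def)
qed

lemma is_metric_graph_attach_loops:
  assumes G: "is_metric_graph G" and I: "finite I"
    and q: "\<And>i. i \<in> I \<Longrightarrow> q i \<in> points G" and c: "\<And>i. i \<in> I \<Longrightarrow> 0 < c i"
  shows "is_metric_graph (attach_loops G I q c)"
proof -
  let ?H = "attach_loops G I q c"
  have "\<forall>i \<in> I. \<exists>x \<in> params G. q i = chart G (fst x) (snd x)"
    using q by (auto simp: points_def image_iff case_prod_beta Bex_def)
  then obtain x where x: "\<And>i. i \<in> I \<Longrightarrow> x i \<in> params G"
    and xq: "\<And>i. i \<in> I \<Longrightarrow> q i = chart G (fst (x i)) (snd (x i))"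
    by metis
  let ?F = "\<lambda>i. {y \<in> params G. chart G (fst y) (snd y) = q i}"
  have finF: "finite (?F i)" if "i \<in> I" for i
  proof (rule finite_subset)
    show "?F i \<subseteq> insert (x i) (glued_params G)"
    proof
      fix y assume "y \<in> ?F i"
      then show "y \<in> insert (x i) (glued_params G)"
        using x[OF that] xq[OF that]
        by (cases "y = x i"; cases "x i"; cases y) (auto simp: glued_params_def intro!: bexI[of _ "x i"])
    qed
    show "finite (insert (x i) (glued_params G))"
      using G by (simp add: is_metric_graph_def)
  qed
  let ?S = "map_prod Inl id ` (glued_params G \<union> (\<Union>i \<in> I. ?F i)) \<union>
      (\<Union>i \<in> I. {(Inr i, 0), (Inr i, c i)})"
  have "glued_params ?H \<subseteq> ?S"
  proof
    fix y assume "y \<in> glued_params ?H"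
    then obtain a t b u where y: "y = (a, t)" "(a, t) \<in> params ?H" "(b, u) \<in> params ?H"
      "(b, u) \<noteq> (a, t)" "chart ?H b u = chart ?H a t"
      unfolding glued_params_def by blast
    show "y \<in> ?S"
    proof (cases a)
      case (Inr i)
      have "i \<in> I" using y(2) Inr by (auto simp: params_def attach_loops_def)
      moreover have "t = 0 \<or> t = c i"
        using y(4,5) Inr by (cases b) (auto simp: attach_loops_def split: if_splits)
      ultimately show ?thesis using y(1) Inr by blast
    next
      case (Inl e)
      have e: "(e, t) \<in> params G" using y(2) Inl by (auto simp: params_def attach_loops_def)
      have "(e, t) \<in> glued_params G \<union> (\<Union>i \<in> I. ?F i)"
      proof (cases b)
        case (Inl e')
        have "(e', u) \<in> params G" using y(3) Inl by (auto simp: params_def attach_loops_def)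
        moreover have "(e', u) \<noteq> (e, t)" using y(4) Inl \<open>a = Inl e\<close> by auto
        moreover have "chart G e' u = chart G e t"
          using y(5) Inl \<open>a = Inl e\<close> by (simp add: attach_loops_def)
        ultimately show ?thesis using e unfolding glued_params_def by blast
      next
        case (Inr i)
        have "i \<in> I" using y(3) Inr by (auto simp: params_def attach_loops_def)
        moreover have "chart G e t = q i"
          using y(5) Inr \<open>a = Inl e\<close> by (auto simp: attach_loops_def split: if_splits)
        ultimately show ?thesis using e by auto
      qed
      then have "map_prod Inl id (e, t) \<in> map_prod Inl id ` (glued_params G \<union> (\<Union>i \<in> I. ?F i))"
        by (rule imageI)
      then show ?thesis using y(1) Inl by simp
    qed
  qed
  moreover have "finite ?S"
    using finF I G by (simp add: is_metric_graph_def)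
  ultimately have fin: "finite (glued_params ?H)"
    by (rule finite_subset)
  have conn: "\<exists>(e, t) \<in> params ?H. \<exists>(e', t') \<in> params ?H.
           e \<in> A \<and> e' \<notin> A \<and> chart ?H e t = chart ?H e' t'"
    if A: "A \<subseteq> edges ?H" "A \<noteq> {}" "A \<noteq> edges ?H" for A
  proof -
    define B where "B = {e \<in> edges G. Inl e \<in> A}"
    have sub: "A \<subseteq> edges G <+> I" "A \<noteq> edges G <+> I"
      using A by (auto simp: attach_loops_def)
    have touch: "(Inl (fst (x i)), snd (x i)) \<in> params ?H" "(Inr i, 0) \<in> params ?H"
      "fst (x i) \<in> edges G"
      "chart ?H (Inl (fst (x i))) (snd (x i)) = chart ?H (Inr i) 0" if "i \<in> I" for i
    proof -
      show "(Inl (fst (x i)), snd (x i)) \<in> params ?H" "fst (x i) \<in> edges G"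
        using x[OF that] by (auto simp: params_def attach_loops_def)
      show "(Inr i, 0) \<in> params ?H"
        using c[OF that] that by (auto simp: params_def attach_loops_def)
      show "chart ?H (Inl (fst (x i))) (snd (x i)) = chart ?H (Inr i) 0"
        using xq[OF that] by (simp add: attach_loops_def)
    qed
    have witness: ?thesis
      if "(e, t) \<in> params ?H" "(e', t') \<in> params ?H" "e \<in> A" "e' \<notin> A"
        "chart ?H e t = chart ?H e' t'" for e t e' t'
      using that by blast
    consider "B = {}" | "B = edges G" | "B \<noteq> {}" "B \<noteq> edges G" by blast
    then show ?thesis
    proof cases
      case 1
      then obtain i where i: "i \<in> I" "Inr i \<in> A"
        using A(2) sub(1) by (fastforce simp: B_def)
      have "Inl (fst (x i)) \<notin> A"
        using 1 touch(3)[OF i(1)] by (auto simp: B_def)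
      from witness[OF touch(2,1)[OF i(1)] i(2) this] touch(4)[OF i(1)] show ?thesis by simp
    next
      case 2
      then obtain i where i: "i \<in> I" "Inr i \<notin> A"
        using sub by (fastforce simp: B_def)
      have "Inl (fst (x i)) \<in> A"
        using 2 touch(3)[OF i(1)] by (auto simp: B_def)
      from witness[OF touch(1,2)[OF i(1)] this i(2)] touch(4)[OF i(1)] show ?thesis by simp
    next
      case 3
      have "B \<subseteq> edges G" by (auto simp: B_def)
      with 3 G have "\<exists>(e, t) \<in> params G. \<exists>(e', t') \<in> params G.
           e \<in> B \<and> e' \<notin> B \<and> chart G e t = chart G e' t'"
        unfolding is_metric_graph_def by simp
      then obtain e t e' t' where e: "(e, t) \<in> params G" "(e', t') \<in> params G"
        "e \<in> B" "e' \<notin> B" "chart G e t = chart G e' t'"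
        by blast
      have "(Inl e, t) \<in> params ?H" "(Inl e', t') \<in> params ?H"
        using e by (auto simp: params_def attach_loops_def)
      moreover have "Inl e \<in> A" "Inl e' \<notin> A"
        using e by (auto simp: B_def params_def)
      moreover have "chart ?H (Inl e) t = chart ?H (Inl e') t'"
        using e by (simp add: attach_loops_def)
      ultimately show ?thesis by (rule witness)
    qed
  qed
  have "finite (edges ?H)" "edges ?H \<noteq> {}" "\<forall>e \<in> edges ?H. 0 < len ?H e"
    using G I c by (auto simp: is_metric_graph_def attach_loops_def)
  moreover have "\<forall>A \<subseteq> edges ?H. A \<noteq> {} \<and> A \<noteq> edges ?H \<longrightarrow>
      (\<exists>(e, t) \<in> params ?H. \<exists>(e', t') \<in> params ?H.
         e \<in> A \<and> e' \<notin> A \<and> chart ?H e t = chart ?H e' t')"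
    by (intro allI impI, elim conjE) (rule conn)
  ultimately show ?thesis
    unfolding is_metric_graph_def by (intro conjI fin)
qed

end

theory Submission
  imports Defs
begin

text \<open>
  Let \<open>D\<close> have degree \<open>2 * r + 1\<close> and rank \<open>r\<close> on the theta graph with loops at
  \<open>q 0, \<dots>, q n\<close>.  The loops are used to push \<open>D\<close> down to the theta graph.  Given a set
  \<open>A\<close> of \<open>r\<close> loops, remove from \<open>D\<close> one general point of each loop in \<open>A\<close>.  The rank
  provides an effective divisor \<open>E\<close> equivalent to the result, and for a general choice of the
  removed points \<open>E\<close> must itself have a point inside each loop of \<open>A\<close>
  (\<open>rank_forces_loop_points\<close>).  Contracting the loops therefore costs two points at \<open>q j\<close>
  for every \<open>j\<close> in \<open>A\<close>, the removed one and the forced one, and a single point \<open>p\<close> of \<open>E\<close>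
  is left over: on the theta graph, the contraction of \<open>D\<close> is equivalent to
  \<open>p + 2 * (\<Sum>j\<in>A. q j)\<close> (\<open>residual_point\<close>).

  This holds for every \<open>A\<close> of size \<open>r\<close>.  For \<open>r = 1\<close> take \<open>A = {j}\<close> with \<open>j \<le> 2\<close>; for
  \<open>r \<ge> 2\<close> take \<open>A = {..r} - {j}\<close>.  Either way there are points \<open>p 0, p 1, p 2\<close> and one sign
  \<open>s\<close> such that the class of \<open>p j + 2 * s * q j\<close> is the same for all \<open>j \<le> 2\<close>.  So for
  \<open>j = 1, 2\<close> there is an equivalence \<open>2 * q 0 + a \<sim> 2 * q j + b\<close>, in which \<open>p 0\<close> plays the
  role of \<open>a\<close> if \<open>s = 1\<close> and of \<open>b\<close> if \<open>s = - 1\<close>.  As \<open>q 0\<close> is the midpoint of its edge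
  and \<open>q j\<close> is not, such an equivalence puts both \<open>a\<close> and \<open>b\<close> on the edge \<open>j\<close>
  (\<open>points_on_edge_of_period_vector\<close>).  Thus \<open>p 0\<close> lies on the edge \<open>1\<close> and on the edge \<open>2\<close>,
  hence is a vertex; but each of the two equivalences excludes one of the vertices for \<open>p 0\<close>,
  and since \<open>q 1\<close> is nearer to \<open>V1\<close> and \<open>q 2\<close> is nearer to \<open>V2\<close>, they do not exclude the same one
  (\<open>no_common_residual_point\<close>).

  All facts about linear equivalence come from one formula: the sum of the values of a
  function \<open>\<phi>\<close> over a principal divisor splits into contributions of the edges, and the
  contribution of an edge on which \<open>\<phi>\<close> is affine is known up to the jumps of \<open>\<phi>\<close> at the ends
  of the edge (\<open>lin_equiv_pairing\<close>, \<open>edge_pairing_affine\<close>).  The function \<open>1\<close> shows that the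
  degree is invariant, the position on a loop gives the constraint that forces points into
  loops, and three piecewise affine weights on the theta graph give its Abel--Jacobi map.
\<close>


section \<open>Piecewise linear functions on a segment\<close>

definition edge_order :: "real \<Rightarrow> (real \<Rightarrow> real) \<Rightarrow> real \<Rightarrow> int" where
  "edge_order L g t =
     (if t < L then slope_up g t else 0) + (if 0 < t then slope_down g t else 0)"

text \<open>
  The restriction to the support of the order keeps the sum finite.
\<close>

definition edge_pairing :: "real \<Rightarrow> (real \<Rightarrow> real) \<Rightarrow> (real \<Rightarrow> real) \<Rightarrow> real" where
  "edge_pairing L g \<psi> = (\<Sum>t | t \<in> {0..L} \<and> edge_order L g t \<noteq> 0. of_int (edge_order L g t) * \<psi> t)"

lemma slope_up_eqI:
  assumes "t < b" "\<And>x. t \<le> x \<Longrightarrow> x \<le> b \<Longrightarrow> g x = a + of_int s * (x - t)"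
  shows "slope_up g t = s"
proof -
  have "((\<lambda>x. a + of_int s * (x - t)) has_real_derivative of_int s) (at_right t)"
    by (auto intro!: derivative_eq_intros)
  then have d: "(g has_real_derivative of_int s) (at_right t)"
  proof (rule has_field_derivative_cong_eventually[THEN iffD1, rotated 2])
    show "\<forall>\<^sub>F x in at_right t. a + of_int s * (x - t) = g x"
      unfolding eventually_at_right_field using assms by (intro exI[of _ b]) simp
    show "a + of_int s * (t - t) = g t" using assms by simp
  qed
  show ?thesis
    unfolding slope_up_def
  proof (rule the_equality)
    show "(g has_real_derivative of_int s) (at_right t)" by (fact d)
  next
    fix s' :: int assume "(g has_real_derivative of_int s') (at_right t)"
    from has_field_derivative_unique[OF this d] show "s' = s"
      by simp
  qed
qed

lemma slope_down_eqI:
  assumes "b < t" "\<And>x. b \<le> x \<Longrightarrow> x \<le> t \<Longrightarrow> g x = a + of_int s * (x - b)"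
  shows "slope_down g t = - s"
proof -
  have "((\<lambda>x. a + of_int s * (x - b)) has_real_derivative of_int s) (at_left t)"
    by (auto intro!: derivative_eq_intros)
  then have d: "(g has_real_derivative of_int s) (at_left t)"
  proof (rule has_field_derivative_cong_eventually[THEN iffD1, rotated 2])
    show "\<forall>\<^sub>F x in at_left t. a + of_int s * (x - b) = g x"
      unfolding eventually_at_left_field using assms by (intro exI[of _ b]) simp
    show "a + of_int s * (t - b) = g t" using assms by simp
  qed
  then have d': "(g has_real_derivative - of_int (- s)) (at_left t)" by simp
  show ?thesis
    unfolding slope_down_def
  proof (rule the_equality)
    show "(g has_real_derivative - of_int (- s)) (at_left t)" by (fact d')
  next
    fix s' :: int assume "(g has_real_derivative - of_int s') (at_left t)"
    from has_field_derivative_unique[OF this d'] show "s' = - s"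
      by simp
  qed
qed

text \<open>
  The sum is evaluated by parts: the order at a breakpoint is the difference of the slopes on
  its two sides, so summing it against \<open>\<alpha> + \<beta> * t\<close> leaves \<open>- \<beta>\<close> times the slopes summed
  against the lengths of the pieces, which is the total increase of \<open>g\<close>.
\<close>

lemma pl_breakpoints:
  assumes pl: "pl_integer_slopes L g" and L: "0 < L"
  obtains B where "finite B" "B \<subseteq> {0..L}"
    "\<And>t. t \<in> {0..L} \<Longrightarrow> t \<notin> B \<Longrightarrow> edge_order L g t = 0"
    "\<And>\<alpha> \<beta>. (\<Sum>t\<in>B. of_int (edge_order L g t) * (\<alpha> + \<beta> * t)) = - \<beta> * (g L - g 0)"
proof -
  obtain k and t :: "nat \<Rightarrow> real" and s :: "nat \<Rightarrow> int"
    where t0: "t 0 = 0" and tk: "t k = L" and step: "\<And>i. i < k \<Longrightarrow> t i < t (Suc i)"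
      and lin: "\<And>i x. i < k \<Longrightarrow> x \<in> {t i..t (Suc i)} \<Longrightarrow> g x = g (t i) + of_int (s i) * (x - t i)"
    using pl unfolding pl_integer_slopes_def by metis
  have mono: "t i < t j" if "i < j" "j \<le> k" for i j
    using that
  proof (induction j)
    case (Suc j)
    then show ?case using step[of j] by (cases "i = j") auto
  qed simp
  have mono_le: "t i \<le> t j" if "i \<le> j" "j \<le> k" for i j
    using mono[of i j] that by (cases "i = j") auto
  have up: "slope_up g x = s i" if "i < k" "t i \<le> x" "x < t (Suc i)" for i x
  proof (rule slope_up_eqI[OF that(3), of g "g (t i) + of_int (s i) * (x - t i)"])
    fix y assume "x \<le> y" "y \<le> t (Suc i)"
    then show "g y = g (t i) + of_int (s i) * (x - t i) + of_int (s i) * (y - x)"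
      using lin[OF that(1), of y] that by (simp add: algebra_simps)
  qed
  have down: "slope_down g x = - s i" if "i < k" "t i < x" "x \<le> t (Suc i)" for i x
  proof (rule slope_down_eqI[OF that(2), of g "g (t i)"])
    fix y assume "t i \<le> y" "y \<le> x"
    then show "g y = g (t i) + of_int (s i) * (y - t i)"
      using lin[OF that(1), of y] that by simp
  qed
  have order: "edge_order L g (t i) = (if i < k then s i else 0) - (if 0 < i then s (i - 1) else 0)"
    if i: "i \<le> k" for i
  proof -
    have "t i < L \<longleftrightarrow> i < k" using mono[of i k] i tk by (cases "i = k") auto
    moreover have "0 < t i \<longleftrightarrow> 0 < i" using mono[of 0 i] i t0 by (cases "i = 0") auto
    moreover have "slope_up g (t i) = s i" if "i < k" using up[OF that, of "t i"] step[OF that] by simp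
    moreover have "slope_down g (t i) = - s (i - 1)" if "0 < i"
      using down[of "i - 1" "t i"] step[of "i - 1"] that i by simp
    ultimately show ?thesis by (auto simp: edge_order_def)
  qed
  have between: "\<exists>i<m. t i < x \<and> x < t (Suc i)"
    if "0 \<le> x" "x \<le> t m" "m \<le> k" "\<And>i. i \<le> m \<Longrightarrow> x \<noteq> t i" for x m
    using that
  proof (induction m)
    case 0
    then show ?case using t0 by force
  next
    case (Suc m)
    show ?case
    proof (cases "x \<le> t m")
      case True
      then show ?thesis using Suc by (metis Suc_leD le_SucI less_SucI)
    next
      case False
      then show ?thesis using Suc by (metis lessI less_eq_real_def not_le order_refl)
    qed
  qed
  have inj: "inj_on t {..k}"
    by (rule linorder_inj_onI) (use mono in force)+
  show ?thesis
  proof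
    show "finite (t ` {..k})" by simp
    show "t ` {..k} \<subseteq> {0..L}" using mono_le[of 0] mono_le[of _ k] t0 tk by auto
  next
    fix x assume "x \<in> {0..L}" "x \<notin> t ` {..k}"
    then obtain i where i: "i < k" "t i < x" "x < t (Suc i)"
      using between[of x k] tk by auto
    moreover have "0 \<le> t i" "t (Suc i) \<le> L"
      using i mono_le[of 0 i] mono_le[of "Suc i" k] t0 tk by auto
    ultimately show "edge_order L g x = 0"
      using up[of i x] down[of i x] by (simp add: edge_order_def)
  next
    fix \<alpha> \<beta> :: real
    have "(\<Sum>x\<in>t ` {..k}. of_int (edge_order L g x) * (\<alpha> + \<beta> * x)) =
        (\<Sum>i\<le>k. of_int (edge_order L g (t i)) * (\<alpha> + \<beta> * t i))"
      by (simp add: sum.reindex[OF inj])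
    also have "\<dots> = (\<Sum>i\<le>k. (if i < k then of_int (s i) * (\<alpha> + \<beta> * t i) else 0)) -
        (\<Sum>i\<le>k. (if 0 < i then of_int (s (i - 1)) * (\<alpha> + \<beta> * t i) else 0))"
      unfolding sum_subtractf[symmetric] by (rule sum.cong) (auto simp: order left_diff_distrib)
    also have "(\<Sum>i\<le>k. (if i < k then of_int (s i) * (\<alpha> + \<beta> * t i) else 0)) =
        (\<Sum>i<k. of_int (s i) * (\<alpha> + \<beta> * t i))"
      by (rule sum.mono_neutral_cong_right) auto
    also have "(\<Sum>i\<le>k. (if 0 < i then of_int (s (i - 1)) * (\<alpha> + \<beta> * t i) else 0)) =
        (\<Sum>i<k. of_int (s i) * (\<alpha> + \<beta> * t (Suc i)))"
      by (subst sum.atMost_shift) simp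
    also have "(\<Sum>i<k. of_int (s i) * (\<alpha> + \<beta> * t i)) - (\<Sum>i<k. of_int (s i) * (\<alpha> + \<beta> * t (Suc i))) =
        (\<Sum>i<k. - \<beta> * (g (t (Suc i)) - g (t i)))"
      unfolding sum_subtractf[symmetric]
    proof (rule sum.cong)
      fix i assume "i \<in> {..<k}"
      then have eq: "g (t (Suc i)) = g (t i) + of_int (s i) * (t (Suc i) - t i)"
        using lin[of i "t (Suc i)"] step[of i] by simp
      show "of_int (s i) * (\<alpha> + \<beta> * t i) - of_int (s i) * (\<alpha> + \<beta> * t (Suc i)) =
          - \<beta> * (g (t (Suc i)) - g (t i))"
        unfolding eq by (simp add: algebra_simps)
    qed simp
    also have "\<dots> = - \<beta> * (g L - g 0)"
      using sum_lessThan_telescope[of "\<lambda>i. g (t i)" k] by (subst sum_distrib_left[symmetric]) (simp add: t0 tk)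
    finally show "(\<Sum>x\<in>t ` {..k}. of_int (edge_order L g x) * (\<alpha> + \<beta> * x)) = - \<beta> * (g L - g 0)" .
  qed
qed

lemma finite_edge_order_support:
  assumes "pl_integer_slopes L g" "0 < L"
  shows "finite {t. t \<in> {0..L} \<and> edge_order L g t \<noteq> 0}"
proof -
  obtain B where "finite B" "\<And>t. t \<in> {0..L} \<Longrightarrow> t \<notin> B \<Longrightarrow> edge_order L g t = 0"
    using pl_breakpoints[OF assms] by metis
  then show ?thesis by (blast intro: finite_subset[of _ B])
qed

lemma edge_pairing_eq_sum:
  assumes "finite T" "T \<subseteq> {0..L}" "\<And>t. t \<in> {0..L} \<Longrightarrow> t \<notin> T \<Longrightarrow> edge_order L g t = 0"
  shows "edge_pairing L g \<psi> = (\<Sum>t\<in>T. of_int (edge_order L g t) * \<psi> t)"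
  unfolding edge_pairing_def
  by (rule sum.mono_neutral_left) (use assms in auto)

text \<open>
  Values of \<open>\<psi>\<close> at the two ends that differ from the affine function inside contribute integer
  multiples of the jump.  A weight on a graph may therefore be discontinuous at the vertices, as
  long as its jumps are integers or otherwise under control.
\<close>

lemma edge_pairing_affine:
  fixes g \<psi> :: "real \<Rightarrow> real"
  assumes pl: "pl_integer_slopes L g" and L: "0 < L"
    and \<psi>: "\<And>t. 0 < t \<Longrightarrow> t < L \<Longrightarrow> \<psi> t = \<alpha> + \<beta> * t"
  shows "edge_pairing L g \<psi> = - \<beta> * (g L - g 0) +
    edge_order L g 0 * (\<psi> 0 - \<alpha>) + edge_order L g L * (\<psi> L - (\<alpha> + \<beta> * L))"
proof -
  let ?o = "\<lambda>t. real_of_int (edge_order L g t)"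
  obtain B where B: "finite B" "B \<subseteq> {0..L}" "\<And>t. t \<in> {0..L} \<Longrightarrow> t \<notin> B \<Longrightarrow> edge_order L g t = 0"
    "(\<Sum>t\<in>B. ?o t * (\<alpha> + \<beta> * t)) = - \<beta> * (g L - g 0)"
    using pl_breakpoints[OF pl L] by metis
  have "edge_pairing L g \<psi> = (\<Sum>t\<in>B. ?o t * \<psi> t)"
    using B by (intro edge_pairing_eq_sum)
  also have "\<dots> = (\<Sum>t\<in>B. ?o t * (\<alpha> + \<beta> * t)) + (\<Sum>t\<in>B. ?o t * (\<psi> t - (\<alpha> + \<beta> * t)))"
    by (simp add: sum.distrib[symmetric] algebra_simps)
  also have "(\<Sum>t\<in>B. ?o t * (\<psi> t - (\<alpha> + \<beta> * t))) = (\<Sum>t\<in>{0, L}. ?o t * (\<psi> t - (\<alpha> + \<beta> * t)))"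
  proof (rule sum.mono_neutral_cong)
    fix t assume "t \<in> B - {0, L}"
    then have "0 < t" "t < L" using B(2) by force+
    then show "?o t * (\<psi> t - (\<alpha> + \<beta> * t)) = 0" by (simp add: \<psi>)
  qed (use B L in auto)
  finally show ?thesis using B(4) L by simp
qed

section \<open>Principal divisors and functions that are affine on the edges\<close>

definition pairing :: "('p \<Rightarrow> real) \<Rightarrow> ('p \<Rightarrow>\<^sub>0 int) \<Rightarrow> real" where
  "pairing \<phi> D = (\<Sum>p \<in> Poly_Mapping.keys D. of_int (Poly_Mapping.lookup D p) * \<phi> p)"

lemma pairing_eq_sum:
  assumes "finite P" "Poly_Mapping.keys D \<subseteq> P"
  shows "pairing \<phi> D = (\<Sum>p\<in>P. of_int (Poly_Mapping.lookup D p) * \<phi> p)"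
  unfolding pairing_def using assms
  by (intro sum.mono_neutral_left) (auto simp: in_keys_iff)

lemma pairing_add: "pairing \<phi> (D + E) = pairing \<phi> D + pairing \<phi> E"
proof -
  let ?P = "Poly_Mapping.keys D \<union> Poly_Mapping.keys E"
  have "pairing \<phi> (D + E) = (\<Sum>p\<in>?P. of_int (Poly_Mapping.lookup (D + E) p) * \<phi> p)"
    by (rule pairing_eq_sum) (auto simp: Poly_Mapping.keys_add)
  then show ?thesis
    by (simp add: pairing_eq_sum[of ?P D] pairing_eq_sum[of ?P E] lookup_add
        distrib_right sum.distrib)
qed

lemma pairing_diff: "pairing \<phi> (D - E) = pairing \<phi> D - pairing \<phi> E"
  using pairing_add[of \<phi> "D - E" E] by simp

lemma pairing_single: "pairing \<phi> (Poly_Mapping.single p k) = k * \<phi> p"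
  by (subst pairing_eq_sum[of "{p}"]) auto

lemma pairing_sum: "pairing \<phi> (sum D A) = (\<Sum>j\<in>A. pairing \<phi> (D j))"
  by (induction A rule: infinite_finite_induct) (simp_all add: pairing_add, simp_all add: pairing_def)

lemma div_degree_eq_pairing: "of_int (div_degree D) = pairing (\<lambda>_. 1) D"
  by (simp add: div_degree_def pairing_def)

lemma finite_fibre:
  assumes "is_metric_graph G"
  shows "finite {(e, t) \<in> params G. chart G e t = p}"
proof (cases "{(e, t) \<in> params G. chart G e t = p} = {}")
  case False
  then obtain e t where x: "(e, t) \<in> params G" "chart G e t = p" by blast
  have "{(e, t) \<in> params G. chart G e t = p} \<subseteq> insert (e, t) (glued_params G)"
    using x by (auto simp: glued_params_def intro!: bexI[of _ "(e, t)"])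
  moreover have "finite (glued_params G)" using assms by (simp add: is_metric_graph_def)
  ultimately show ?thesis by (meson finite_insert finite_subset)
next
  case True
  then show ?thesis by (metis finite.emptyI)
qed

text \<open>
  A discrete Green formula: the order of \<open>f\<close> at a point collects the orders at all parameters
  of that point, so that summing over points is the same as summing edge by edge.
\<close>

lemma lin_equiv_pairing:
  assumes G: "is_metric_graph G" and "lin_equiv G D E"
  obtains f where "rational_function G f"
    "\<And>\<phi>. pairing \<phi> D - pairing \<phi> E =
       (\<Sum>e\<in>edges G. edge_pairing (len G e) (f \<circ> chart G e) (\<phi> \<circ> chart G e))"
proof -
  obtain f where f: "rational_function G f"
    and ord: "\<And>p. Poly_Mapping.lookup (D - E) p = ord_at G f p"
    using assms unfolding lin_equiv_def by blast
  let ?o = "\<lambda>(e, t). edge_order (len G e) (f \<circ> chart G e) t"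
  let ?c = "\<lambda>(e, t). chart G e t"
  let ?T = "\<lambda>e. {t \<in> {0..len G e}. ?o (e, t) \<noteq> 0}"
  have finE: "finite (edges G)" using G by (simp add: is_metric_graph_def)
  have finT: "finite (?T e)" if "e \<in> edges G" for e
    using finite_edge_order_support[of "len G e" "f \<circ> chart G e"] f G that
    by (auto simp: rational_function_def is_metric_graph_def)
  define X where "X = (SIGMA e:edges G. ?T e)"
  \<comment> \<open>\<open>ord_at\<close> may vanish at a point while the orders at its parameters cancel; \<open>P\<close> has to
    contain such points as well.\<close>
  define P where "P = Poly_Mapping.keys (D - E) \<union> ?c ` X"
  define Y where "Y = {x \<in> params G. ?c x \<in> P}"
  have finX: "finite X" unfolding X_def using finE finT by blast
  then have finP: "finite P" by (simp add: P_def)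
  have fib: "{x \<in> params G. ?c x = p} = {(e, t) \<in> params G. chart G e t = p}" for p
    by auto
  have "Y = (\<Union>p\<in>P. {x \<in> params G. ?c x = p})" by (auto simp: Y_def)
  then have finY: "finite Y" using finP finite_fibre[OF G] by (simp add: fib)
  have XY: "X \<subseteq> Y" by (auto simp: X_def Y_def P_def params_def)
  show ?thesis
  proof
    fix \<phi> :: "'b \<Rightarrow> real"
    have "pairing \<phi> D - pairing \<phi> E = pairing \<phi> (D - E)" by (simp add: pairing_diff)
    also have "\<dots> = (\<Sum>p\<in>P. of_int (ord_at G f p) * \<phi> p)"
      by (subst pairing_eq_sum[OF finP]) (auto simp: P_def ord)
    also have "\<dots> = (\<Sum>p\<in>P. \<Sum>x | x \<in> Y \<and> ?c x = p. of_int (?o x) * \<phi> (?c x))"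
    proof (rule sum.cong)
      fix p assume p: "p \<in> P"
      have "{x. x \<in> Y \<and> ?c x = p} = {(e, t) \<in> params G. chart G e t = p}"
        using p by (auto simp: Y_def)
      moreover have "of_int (ord_at G f p) =
          (\<Sum>x\<in>{(e, t) \<in> params G. chart G e t = p}. real_of_int (?o x))"
        unfolding ord_at_def of_int_sum by (rule sum.cong) (auto simp: edge_order_def)
      ultimately show "of_int (ord_at G f p) * \<phi> p =
          (\<Sum>x | x \<in> Y \<and> ?c x = p. of_int (?o x) * \<phi> (?c x))"
        by (auto simp: sum_distrib_right intro!: sum.cong)
    qed simp
    also have "\<dots> = (\<Sum>x\<in>Y. of_int (?o x) * \<phi> (?c x))"
      by (rule sum.group) (use finP finY in \<open>auto simp: Y_def\<close>)
    also have "\<dots> = (\<Sum>x\<in>X. of_int (?o x) * \<phi> (?c x))"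
      by (rule sum.mono_neutral_right) (use finY XY in \<open>auto simp: X_def Y_def params_def\<close>)
    also have "\<dots> = (\<Sum>e\<in>edges G. \<Sum>t\<in>?T e. of_int (?o (e, t)) * \<phi> (?c (e, t)))"
      unfolding X_def by (subst sum.Sigma) (use finE finT in \<open>auto intro!: sum.cong\<close>)
    finally show "pairing \<phi> D - pairing \<phi> E =
       (\<Sum>e\<in>edges G. edge_pairing (len G e) (f \<circ> chart G e) (\<phi> \<circ> chart G e))"
      by (simp add: edge_pairing_def)
  qed (fact f)
qed

lemma lin_equiv_div_degree_eq:
  assumes "is_metric_graph G" "lin_equiv G D E"
  shows "div_degree D = div_degree E"
proof -
  obtain f where f: "rational_function G f"
    "\<And>\<phi>. pairing \<phi> D - pairing \<phi> E =
       (\<Sum>e\<in>edges G. edge_pairing (len G e) (f \<circ> chart G e) (\<phi> \<circ> chart G e))"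
    using lin_equiv_pairing[OF assms] by metis
  have "edge_pairing (len G e) (f \<circ> chart G e) ((\<lambda>_. 1 :: real) \<circ> chart G e) = 0" if "e \<in> edges G" for e
    using edge_pairing_affine[of "len G e" "f \<circ> chart G e" "(\<lambda>_. 1) \<circ> chart G e" 1 0]
      assms(1) f(1) that by (auto simp: is_metric_graph_def rational_function_def)
  then have "pairing (\<lambda>_. 1) D - pairing (\<lambda>_. 1) E = 0"
    by (simp add: f(2))
  then have "real_of_int (div_degree D) = of_int (div_degree E)"
    by (simp add: div_degree_eq_pairing)
  then show ?thesis by simp
qed

section \<open>Degree and rank\<close>

lemma div_degree_diff: "div_degree (D - E) = div_degree D - div_degree E"
  using pairing_diff[of "\<lambda>_. 1" D E] by (simp flip: div_degree_eq_pairing of_int_diff)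

lemma effective_degree_nonneg: "effective D \<Longrightarrow> 0 \<le> div_degree D"
  by (simp add: effective_def div_degree_def sum_nonneg)

lemma effective_degree_0:
  assumes "effective D" "div_degree D = 0"
  shows "D = 0"
proof -
  have "Poly_Mapping.lookup D p = 0" if "p \<in> Poly_Mapping.keys D" for p
    using assms that unfolding effective_def div_degree_def
    by (subst (asm) sum_nonneg_eq_0_iff) auto
  then show ?thesis by (intro poly_mapping_eqI) (auto simp: in_keys_iff)
qed

text \<open>
  A maximum of an unbounded set of natural numbers would be an arbitrary value.  Here the set
  is bounded: an effective divisor of degree \<open>s\<close> concentrated at one point can be removed from
  \<open>D\<close> only if \<open>s \<le> div_degree D\<close>, because equivalent divisors have the same degree.
\<close>

lemma linear_system_diff_nonempty:
  fixes D F :: "'p \<Rightarrow>\<^sub>0 int"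
  assumes G: "is_metric_graph G" and rk: "div_rank G D = int r"
    and F: "divisor G F" "effective F" "div_degree F = int r"
  shows "linear_system G (D - F) \<noteq> {}"
proof -
  let ?Q = "\<lambda>r. \<forall>F :: 'p \<Rightarrow>\<^sub>0 int. divisor G F \<and> effective F \<and> div_degree F = int r \<longrightarrow>
                                linear_system G (D - F) \<noteq> {}"
  have ne: "linear_system G D \<noteq> {}" and r: "r = (GREATEST r. ?Q r)"
    using rk by (auto simp: div_rank_def split: if_splits)
  obtain p where p: "p \<in> points G"
  proof -
    obtain e where "e \<in> edges G" "0 < len G e" using G by (auto simp: is_metric_graph_def)
    then have "chart G e 0 \<in> points G" by (force simp: points_def params_def)
    then show ?thesis by (rule that)
  qed
  have "?Q 0"
  proof (intro allI impI, elim conjE)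
    fix F :: "'p \<Rightarrow>\<^sub>0 int"
    assume "effective F" "div_degree F = int 0"
    then have "F = 0" by (intro effective_degree_0) simp_all
    then show "linear_system G (D - F) \<noteq> {}" using ne by simp
  qed
  moreover have "s \<le> nat (div_degree D)" if "?Q s" for s
  proof -
    let ?F = "Poly_Mapping.single p (int s)"
    have deg: "div_degree ?F = int s" by (auto simp: div_degree_def)
    moreover have "divisor G ?F" "effective ?F"
      using p by (auto simp: divisor_def effective_def lookup_single when_def)
    ultimately obtain E where "E \<in> linear_system G (D - ?F)" using \<open>?Q s\<close> by blast
    then have "effective E" "lin_equiv G E (D - ?F)" by (auto simp: linear_system_def)
    then have "0 \<le> div_degree D - int s"
      using lin_equiv_div_degree_eq[OF G] effective_degree_nonneg div_degree_diff deg by metis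
    then show ?thesis by simp
  qed
  ultimately have "?Q (GREATEST r. ?Q r)"
    by (rule GreatestI_nat)
  then show ?thesis using F r by auto
qed


section \<open>Loops and their contraction\<close>

definition loop_position :: "'i \<Rightarrow> 'p + 'i \<times> real \<Rightarrow> real" where
  "loop_position j x = (case x of Inl _ \<Rightarrow> 0 | Inr (i, t) \<Rightarrow> if i = j then t else 0)"

text \<open>
  On the loop \<open>j\<close> the position is affine except for a jump by \<open>c j\<close> where the loop closes up, and
  a rational function takes equal values at both ends of the loop.  This is one half of Abel's
  theorem for a circle.
\<close>

lemma loop_position_pairing:
  fixes G :: "('e, 'p) metric_graph" and I :: "'i set"
    and q :: "'i \<Rightarrow> 'p" and c :: "'i \<Rightarrow> real"
  defines "H \<equiv> attach_loops G I q c"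
  assumes H: "is_metric_graph H" and I: "finite I" "j \<in> I" and fin: "finite (edges G)"
    and eq: "lin_equiv H D E"
  shows "\<exists>m :: int. pairing (loop_position j) D - pairing (loop_position j) E = m * c j"
proof -
  let ?\<phi> = "loop_position j :: 'p + 'i \<times> real \<Rightarrow> real"
  obtain f where f: "rational_function H f"
    "\<And>\<phi>. pairing \<phi> D - pairing \<phi> E =
       (\<Sum>e\<in>edges H. edge_pairing (len H e) (f \<circ> chart H e) (\<phi> \<circ> chart H e))"
    using lin_equiv_pairing[OF H eq] by blast
  let ?P = "\<lambda>e. edge_pairing (len H e) (f \<circ> chart H e) (?\<phi> \<circ> chart H e)"
  have edge: "edges H = edges G <+> I" "\<And>e. len H (Inl e) = len G e" "\<And>i. len H (Inr i) = c i"
    "\<And>e t. chart H (Inl e) t = Inl (chart G e t)"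
    "\<And>i t. chart H (Inr i) t = (if t = 0 \<or> t = c i then Inl (q i) else Inr (i, t))"
    by (simp_all add: H_def attach_loops_def)
  have pl: "pl_integer_slopes (len H e) (f \<circ> chart H e)" "0 < len H e" if "e \<in> edges H" for e
    using H f(1) that by (simp_all add: is_metric_graph_def rational_function_def)
  have other: "?P e = 0" if "e \<noteq> Inr j" for e
    unfolding edge_pairing_def using that
    by (intro sum.neutral) (cases e; auto simp: edge loop_position_def)
  have "Inr j \<in> edges H" using I by (simp add: edge InrI)
  note pl = pl[OF this]
  have "?P (Inr j) = of_int (- edge_order (c j) (f \<circ> chart H (Inr j)) (c j)) * c j"
    using edge_pairing_affine[OF pl, of "?\<phi> \<circ> chart H (Inr j)" 0 1] pl(2)
    by (simp add: edge loop_position_def)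
  moreover have "(\<Sum>e\<in>edges H. ?P e) = (\<Sum>e\<in>{Inr j}. ?P e)"
    using I fin by (intro sum.mono_neutral_right) (auto simp: edge other)
  ultimately show ?thesis
    unfolding f(2) by (intro exI[of _ "- edge_order (c j) (f \<circ> chart H (Inr j)) (c j)"]) simp
qed

definition base_point :: "('i \<Rightarrow> 'p) \<Rightarrow> 'p + 'i \<times> real \<Rightarrow> 'p" where
  "base_point q x = (case x of Inl p \<Rightarrow> p | Inr (i, t) \<Rightarrow> q i)"

text \<open>
  Functions that are constant on each loop do not see the loops: contracting them turns a
  principal divisor into the divisor of the restriction of \<open>f\<close> to \<open>G\<close>.
\<close>

lemma base_point_pairing:
  fixes G :: "('e, 'p) metric_graph" and I :: "'i set"
    and q :: "'i \<Rightarrow> 'p" and c :: "'i \<Rightarrow> real"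
  defines "H \<equiv> attach_loops G I q c"
  assumes H: "is_metric_graph H" and I: "finite I" and fin: "finite (edges G)"
    and eq: "lin_equiv H D E"
  obtains f where "rational_function G f"
    "\<And>\<phi>. pairing (\<phi> \<circ> base_point q) D - pairing (\<phi> \<circ> base_point q) E =
       (\<Sum>e\<in>edges G. edge_pairing (len G e) (f \<circ> chart G e) (\<phi> \<circ> chart G e))"
proof -
  obtain f where f: "rational_function H f"
    "\<And>\<phi>. pairing \<phi> D - pairing \<phi> E =
       (\<Sum>e\<in>edges H. edge_pairing (len H e) (f \<circ> chart H e) (\<phi> \<circ> chart H e))"
    using lin_equiv_pairing[OF H eq] by blast
  have edge: "edges H = edges G <+> I" "\<And>e. len H (Inl e) = len G e" "\<And>i. len H (Inr i) = c i"
    "\<And>e. chart H (Inl e) = Inl \<circ> chart G e"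
    "\<And>i t. chart H (Inr i) t = (if t = 0 \<or> t = c i then Inl (q i) else Inr (i, t))"
    by (auto simp add: H_def attach_loops_def)
  have pl: "pl_integer_slopes (len H e) (f \<circ> chart H e)" "0 < len H e" if "e \<in> edges H" for e
    using H f(1) that by (simp_all add: is_metric_graph_def rational_function_def)
  show ?thesis
  proof
    show "rational_function G (f \<circ> Inl)"
      using pl(1)[of "Inl _"] by (auto simp: rational_function_def edge comp_assoc)
  next
    fix \<phi> :: "'p \<Rightarrow> real"
    have loop: "edge_pairing (len H (Inr i)) (f \<circ> chart H (Inr i))
        (\<phi> \<circ> base_point q \<circ> chart H (Inr i)) = 0" if "i \<in> I" for i
    proof -
      have "Inr i \<in> edges H" using that by (simp add: edge InrI)
      from edge_pairing_affine[OF pl[OF this], of "\<phi> \<circ> base_point q \<circ> chart H (Inr i)" "\<phi> (q i)" 0]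
      show ?thesis by (simp add: edge base_point_def)
    qed
    have base: "\<phi> \<circ> base_point q \<circ> (Inl \<circ> chart G e) = \<phi> \<circ> chart G e" for e
      by (simp add: fun_eq_iff base_point_def)
    show "pairing (\<phi> \<circ> base_point q) D - pairing (\<phi> \<circ> base_point q) E =
       (\<Sum>e\<in>edges G. edge_pairing (len G e) (f \<circ> Inl \<circ> chart G e) (\<phi> \<circ> chart G e))"
      unfolding f(2) edge(1) sum.Plus[OF fin I] sum.neutral[OF ballI[OF loop]]
      by (simp add: loop) (simp add: edge base comp_assoc base[unfolded comp_assoc])
  qed
qed

definition loop_divisor :: "'i set \<Rightarrow> ('i \<Rightarrow> real) \<Rightarrow> ('p + 'i \<times> real \<Rightarrow>\<^sub>0 int)" where
  "loop_divisor A x = (\<Sum>j\<in>A. Poly_Mapping.single (Inr (j, x j)) 1)"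

lemma lookup_loop_divisor:
  assumes "finite A"
  shows "Poly_Mapping.lookup (loop_divisor A x) z =
    (case z of Inl _ \<Rightarrow> 0 | Inr (j, t) \<Rightarrow> if j \<in> A \<and> t = x j then 1 else 0)"
proof -
  have "Poly_Mapping.lookup (loop_divisor A x) z = (\<Sum>j\<in>A. if Inr (j, x j) = z then 1 else 0)"
    by (auto simp: loop_divisor_def lookup_sum lookup_single when_def intro!: sum.cong)
  also have "\<dots> = (\<Sum>j\<in>A. case z of Inl _ \<Rightarrow> 0 | Inr (i, t) \<Rightarrow> if j = i then if t = x i then 1 else 0 else 0)"
    by (rule sum.cong) (auto split: sum.splits)
  finally show ?thesis using assms by (auto split: sum.splits)
qed

lemma keys_loop_divisor:
  "finite A \<Longrightarrow> Poly_Mapping.keys (loop_divisor A x) = (\<lambda>j. Inr (j, x j)) ` A"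
  by (auto simp: in_keys_iff lookup_loop_divisor split: sum.splits if_splits)

lemma pairing_loop_divisor: "pairing \<phi> (loop_divisor A x) = (\<Sum>j\<in>A. \<phi> (Inr (j, x j)))"
  by (simp add: loop_divisor_def pairing_sum pairing_single)

lemma div_degree_loop_divisor: "div_degree (loop_divisor A x) = int (card A)"
proof -
  have "real_of_int (div_degree (loop_divisor A x)) = of_int (int (card A))"
    by (simp add: div_degree_eq_pairing pairing_loop_divisor)
  then show ?thesis by (simp only: of_int_eq_iff)
qed

lemma effective_degree_1:
  assumes "effective D" "div_degree D = 1"
  obtains p where "D = Poly_Mapping.single p 1"
proof -
  have "D \<noteq> 0" using assms(2) by (auto simp: div_degree_def)
  then obtain p where "Poly_Mapping.lookup D p \<noteq> 0" by (metis lookup_zero poly_mapping_eqI)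
  then have p: "Poly_Mapping.lookup D p \<ge> 1" using assms(1) by (simp add: effective_def order_less_le int_one_le_iff_zero_less)
  have "effective (D - Poly_Mapping.single p 1)"
    using assms(1) p by (auto simp: effective_def lookup_minus lookup_single when_def)
  moreover have "div_degree (Poly_Mapping.single p 1) = 1" by (simp add: div_degree_def)
  ultimately have "D - Poly_Mapping.single p 1 = 0"
    using assms(2) by (intro effective_degree_0) (simp_all add: div_degree_diff)
  then show ?thesis using that[of p] by simp
qed

text \<open>
  Two points at distance \<open>c / 3\<close> on a circle of length \<open>c\<close> cannot both be congruent to \<open>y\<close>.
\<close>

lemma exists_generic_loop_position:
  fixes c y :: real
  assumes "0 < c"
  shows "\<exists>x. 0 < x \<and> x < c \<and> (\<forall>m :: int. x - y \<noteq> m * c)"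
proof -
  have False if "c / 3 - y = of_int m * c" "2 * c / 3 - y = of_int m' * c" for m m' :: int
  proof -
    have "c * (3 * of_int (m' - m)) = c * 1" using that by (simp add: algebra_simps)
    then have "real_of_int (3 * (m' - m)) = of_int 1"
      using assms by (subst (asm) mult_cancel_left) simp
    then have "3 * (m' - m) = 1" by (simp only: of_int_eq_iff)
    then show False by presburger
  qed
  then have "(\<forall>m :: int. c / 3 - y \<noteq> m * c) \<or> (\<forall>m :: int. 2 * c / 3 - y \<noteq> m * c)"
    by blast
  then show ?thesis
  proof
    assume "\<forall>m :: int. c / 3 - y \<noteq> m * c"
    then show ?thesis using assms by (intro exI[of _ "c / 3"]) simp
  next
    assume "\<forall>m :: int. 2 * c / 3 - y \<noteq> m * c"
    then show ?thesis using assms by (intro exI[of _ "2 * c / 3"]) simp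
  qed
qed

text \<open>
  The point \<open>x j\<close> is chosen such that the position sum of \<open>D - loop_divisor A x\<close> on the loop \<open>j\<close>
  is not a multiple of \<open>c j\<close>.  An equivalent divisor without a point inside that loop would have
  position sum \<open>0\<close>, contradicting \<open>loop_position_pairing\<close>.
\<close>

lemma rank_forces_loop_points:
  fixes G :: "('e, 'p) metric_graph" and I :: "'i set"
    and q :: "'i \<Rightarrow> 'p" and c :: "'i \<Rightarrow> real"
  defines "H \<equiv> attach_loops G I q c"
  assumes H: "is_metric_graph H" and I: "finite I" and fin: "finite (edges G)"
    and c: "\<And>i. i \<in> I \<Longrightarrow> 0 < c i"
    and rk: "div_rank H D = int r" and A: "A \<subseteq> I" "card A = r"
  obtains x y R where "divisor H R" "effective R"
    "lin_equiv H (loop_divisor A y + R) (D - loop_divisor A x)"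
proof -
  have finA: "finite A" using A I finite_subset by blast
  have "\<forall>j\<in>I. \<exists>x. 0 < x \<and> x < c j \<and> (\<forall>m :: int. x - pairing (loop_position j) D \<noteq> m * c j)"
    using exists_generic_loop_position c by blast
  then obtain x where x: "\<And>j. j \<in> I \<Longrightarrow> 0 < x j" "\<And>j. j \<in> I \<Longrightarrow> x j < c j"
    "\<And>j m. j \<in> I \<Longrightarrow> x j - pairing (loop_position j) D \<noteq> of_int m * c j"
    by metis
  define F :: "'p + 'i \<times> real \<Rightarrow>\<^sub>0 int" where "F = loop_divisor A x"
  have "Inr (j, x j) \<in> points H" if "j \<in> A" for j
  proof -
    have "(Inr j, x j) \<in> params H" "chart H (Inr j) (x j) = Inr (j, x j)"
      using x(1,2)[of j] that A by (auto simp: H_def params_def attach_loops_def)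
    then show ?thesis unfolding points_def by force
  qed
  then have "divisor H F" by (auto simp: divisor_def F_def keys_loop_divisor[OF finA])
  moreover have "effective F"
    by (auto simp: effective_def F_def lookup_loop_divisor[OF finA] split: sum.splits)
  moreover have "div_degree F = int r" by (simp add: F_def div_degree_loop_divisor A)
  ultimately obtain E where "E \<in> linear_system H (D - F)"
    using linear_system_diff_nonempty[OF H rk] by blast
  then have E: "divisor H E" "effective E" "lin_equiv H E (D - F)"
    by (auto simp: linear_system_def)
  have "\<exists>t. Inr (j, t) \<in> Poly_Mapping.keys E" if j: "j \<in> A" for j
  proof (rule ccontr)
    assume none: "\<not> ?thesis"
    have "pairing (loop_position j) E = 0"
      unfolding pairing_def
    proof (rule sum.neutral, rule ballI)
      fix z assume "z \<in> Poly_Mapping.keys E"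
      then show "of_int (Poly_Mapping.lookup E z) * loop_position j z = 0"
        using none by (cases z) (auto simp: loop_position_def split: if_splits)
    qed
    moreover have "pairing (loop_position j) F = (\<Sum>i\<in>A. if i = j then x j else 0)"
      unfolding F_def pairing_loop_divisor by (rule sum.cong) (auto simp: loop_position_def)
    then have "pairing (loop_position j) F = x j" using finA j by simp
    moreover obtain m :: int where
      "pairing (loop_position j) E - pairing (loop_position j) (D - F) = m * c j"
      using loop_position_pairing[OF H[unfolded H_def] I _ fin E(3)[unfolded H_def], of j] j A by blast
    ultimately show False using x(3)[of j m] j A by (auto simp: pairing_diff)
  qed
  then obtain y where y: "\<And>j. j \<in> A \<Longrightarrow> Inr (j, y j) \<in> Poly_Mapping.keys E" by metis
  define R where "R = E - loop_divisor A y"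
  have "effective R"
    unfolding effective_def
  proof
    fix z
    show "0 \<le> Poly_Mapping.lookup R z"
    proof (cases "z \<in> (\<lambda>j. Inr (j, y j)) ` A")
      case True
      then have "Poly_Mapping.lookup E z \<noteq> 0" using y by (auto simp: in_keys_iff)
      then have "Poly_Mapping.lookup E z \<ge> 1" using E(2) unfolding effective_def
        by (metis int_one_le_iff_zero_less order_less_le)
      then show ?thesis using True by (auto simp: R_def lookup_minus lookup_loop_divisor[OF finA])
    next
      case False
      then have "Poly_Mapping.lookup (loop_divisor A y) z = 0"
        by (simp add: keys_loop_divisor[OF finA] flip: not_in_keys_iff_lookup_eq_zero)
      then show ?thesis using E(2) by (simp add: R_def lookup_minus effective_def)
    qed
  qed
  moreover have "divisor H R"
    using E(1) y keys_diff[of E "loop_divisor A y"]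
    by (fastforce simp: divisor_def R_def keys_loop_divisor[OF finA])
  moreover have "lin_equiv H (loop_divisor A y + R) (D - loop_divisor A x)"
    using E(3) by (simp add: R_def F_def)
  ultimately show ?thesis using that by blast
qed

lemma base_point_in_points:
  assumes "\<And>i. i \<in> I \<Longrightarrow> q i \<in> points G" and "z \<in> points (attach_loops G I q c)"
  shows "base_point q z \<in> points G"
proof -
  obtain e t where "(e, t) \<in> params (attach_loops G I q c)" "z = chart (attach_loops G I q c) e t"
    using assms(2) by (auto simp: points_def)
  then show ?thesis
    using assms(1)
    by (cases e) (auto simp: points_def params_def attach_loops_def base_point_def)
qed

section \<open>The Abel--Jacobi map of the theta graph\<close>

text \<open>
  The weights of the edges \<open>0, 1, 2\<close> are the coordinates of an Abel--Jacobi map.  On its own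
  edge each weight falls linearly from \<open>1\<close> at \<open>V1\<close> to \<open>0\<close> at \<open>V2\<close>; but \<open>V1\<close> is assigned to
  the edge \<open>0\<close> only, so that every point has at most one nonzero weight.  Any other edge would do
  as well, since the weight vector of \<open>V1\<close> would change by an integer vector with coordinate
  sum zero, that is, by a period.
\<close>

definition theta_weight :: "(nat \<Rightarrow> real) \<Rightarrow> nat \<Rightarrow> theta_point \<Rightarrow> real" where
  "theta_weight l i p = (case p of V1 \<Rightarrow> if i = 0 then 1 else 0 | V2 \<Rightarrow> 0
     | Inner j t \<Rightarrow> if j = i then 1 - t / l i else 0)"

text \<open>
  The values of the weights on principal divisors: \<open>\<delta>\<close> is the increase of the rational function
  from \<open>V1\<close> to \<open>V2\<close>, and the integers \<open>k i\<close> come from its slopes at \<open>V1\<close>.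
\<close>

definition period_vector :: "(nat \<Rightarrow> real) \<Rightarrow> (nat \<Rightarrow> real) \<Rightarrow> bool" where
  "period_vector l w \<longleftrightarrow> (\<exists>\<delta> (k :: nat \<Rightarrow> int). k 0 + k 1 + k 2 = (0 :: int) \<and>
     (\<forall>i\<le>2. w i = \<delta> / l i + k i))"

lemma period_vector_add:
  assumes "period_vector l v" "period_vector l w"
  shows "period_vector l (\<lambda>i. v i + w i)"
proof -
  obtain \<delta> and k :: "nat \<Rightarrow> int" where 1: "k 0 + k 1 + k 2 = (0 :: int)"
    "\<forall>i\<le>2. v i = \<delta> / l i + k i"
    using assms(1) unfolding period_vector_def by blast
  obtain \<delta>' and k' :: "nat \<Rightarrow> int" where 2: "k' 0 + k' 1 + k' 2 = (0 :: int)"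
    "\<forall>i\<le>2. w i = \<delta>' / l i + k' i"
    using assms(2) unfolding period_vector_def by blast
  show ?thesis
    unfolding period_vector_def
    by (intro exI[of _ "\<delta> + \<delta>'"] exI[of _ "\<lambda>i. k i + k' i"])
      (use 1 2 in \<open>simp add: add_divide_distrib\<close>)
qed

lemma period_vector_minus:
  assumes "period_vector l v"
  shows "period_vector l (\<lambda>i. - v i)"
proof -
  obtain \<delta> and k :: "nat \<Rightarrow> int" where 1: "k 0 + k 1 + k 2 = (0 :: int)"
    "\<forall>i\<le>2. v i = \<delta> / l i + k i"
    using assms(1) unfolding period_vector_def by blast
  show ?thesis
    unfolding period_vector_def
    by (intro exI[of _ "- \<delta>"] exI[of _ "\<lambda>i. - k i"]) (use 1 in simp)
qed

lemma period_vector_of_int: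
  fixes k :: "nat \<Rightarrow> int"
  assumes "k 0 + k 1 + k 2 = 0"
  shows "period_vector l (\<lambda>i. k i)"
  unfolding period_vector_def
  by (intro exI[of _ 0] exI[of _ k]) (use assms in simp)

lemma period_vector_cong:
  assumes "period_vector l v" "\<And>i. i \<le> 2 \<Longrightarrow> w i = v i"
  shows "period_vector l w"
  using assms unfolding period_vector_def by simp

lemma theta_weight_pairing:
  assumes l: "\<And>i. i \<le> 2 \<Longrightarrow> 0 < l i" and f: "rational_function (theta_graph l) f"
  shows "period_vector l (\<lambda>i. \<Sum>e\<in>edges (theta_graph l). edge_pairing (len (theta_graph l) e)
      (f \<circ> chart (theta_graph l) e) (theta_weight l i \<circ> chart (theta_graph l) e))"
proof -
  let ?G = "theta_graph l"
  define o0 where "o0 e = edge_order (l e) (f \<circ> chart ?G e) 0" for e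
  define \<delta> where "\<delta> = f V2 - f V1"
  have edge: "edges ?G = {..2}" "len ?G = l"
    "\<And>e t. chart ?G e t = (if t = 0 then V1 else if t = l e then V2 else Inner e t)"
    by (simp_all add: theta_graph_def)
  have edge_value: "edge_pairing (l e) (f \<circ> chart ?G e) (theta_weight l i \<circ> chart ?G e) =
      (if e = i then \<delta> / l i - o0 i else 0) + (if i = 0 then o0 e else 0)" if "e \<le> 2" for e i
  proof -
    have pl: "pl_integer_slopes (l e) (f \<circ> chart ?G e)"
      using f that by (auto simp: rational_function_def edge)
    show ?thesis
    proof (cases "e = i")
      case True
      have "edge_pairing (l e) (f \<circ> chart ?G e) (theta_weight l i \<circ> chart ?G e) =
         - (- 1 / l e) * ((f \<circ> chart ?G e) (l e) - (f \<circ> chart ?G e) 0) +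
         o0 e * ((theta_weight l i \<circ> chart ?G e) 0 - 1) +
         edge_order (l e) (f \<circ> chart ?G e) (l e) *
           ((theta_weight l i \<circ> chart ?G e) (l e) - (1 + (- 1 / l e) * l e))"
        unfolding o0_def
        by (rule edge_pairing_affine[OF pl l[OF that]])
          (use True in \<open>simp add: edge theta_weight_def\<close>)
      also have "\<dots> = \<delta> / l e + o0 e * ((if i = 0 then 1 else 0) - 1)"
        using l[OF that] by (simp add: edge theta_weight_def \<delta>_def)
      finally show ?thesis using True by simp
    next
      case False
      have "edge_pairing (l e) (f \<circ> chart ?G e) (theta_weight l i \<circ> chart ?G e) =
         - 0 * ((f \<circ> chart ?G e) (l e) - (f \<circ> chart ?G e) 0) +
         o0 e * ((theta_weight l i \<circ> chart ?G e) 0 - 0) +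
         edge_order (l e) (f \<circ> chart ?G e) (l e) *
           ((theta_weight l i \<circ> chart ?G e) (l e) - (0 + 0 * l e))"
        unfolding o0_def
        by (rule edge_pairing_affine[OF pl l[OF that]])
          (use False in \<open>simp add: edge theta_weight_def\<close>)
      then show ?thesis using False l[OF that] by (simp add: edge theta_weight_def)
    qed
  qed
  have set: "{..2} = {0, 1, 2::nat}" by auto
  show ?thesis
    unfolding period_vector_def
  proof (intro exI[of _ \<delta>] exI[of _ "\<lambda>i. (if i = 0 then o0 0 + o0 1 + o0 2 else 0) - o0 i"] conjI allI impI)
    fix i :: nat assume "i \<le> 2"
    then have "i = 0 \<or> i = 1 \<or> i = 2" by auto
    then show "(\<Sum>e\<in>edges ?G. edge_pairing (len ?G e)
      (f \<circ> chart ?G e) (theta_weight l i \<circ> chart ?G e)) =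
      \<delta> / l i + of_int ((if i = 0 then o0 0 + o0 1 + o0 2 else 0) - o0 i)"
      unfolding edge(1,2) set by (auto simp: edge_value)
  qed simp
qed

section \<open>Equivalences between divisors of the form 2q + a\<close>

lemma theta_graph_points:
  assumes "p \<in> points (theta_graph l)"
  shows "p = V1 \<or> p = V2 \<or> (\<exists>i t. p = Inner i t \<and> i \<le> 2 \<and> 0 < t \<and> t < l i)"
proof -
  from assms obtain i t where "i \<le> 2" "0 \<le> t" "t \<le> l i" "p = chart (theta_graph l) i t"
    by (auto simp: points_def params_def theta_graph_def simp del: if_split)
  then show ?thesis by (cases "t = 0"; cases "t = l i") (auto simp: theta_graph_def)
qed

text \<open>
  The hypothesis \<open>per\<close> encodes an equivalence \<open>2 * m + a \<sim> 2 * q + b\<close>, where \<open>m\<close> is the midpoint of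
  the edge \<open>0\<close> and \<open>q\<close> is the point of the edge \<open>e\<close> of weight \<open>(1 + \<theta>) / 2\<close>, which is nearer to
  \<open>V1\<close> than to \<open>V2\<close>: the weights of \<open>2 * m - 2 * q\<close> are \<open>1\<close> at \<open>0\<close> and \<open>- (1 + \<theta>)\<close> at \<open>e\<close>,
  hence \<open>- \<theta>\<close> at \<open>e\<close> up to a period.

  Each of \<open>a\<close> and \<open>b\<close> has a nonzero weight on at most one edge.  Therefore \<open>\<delta>\<close> vanishes: it has
  the same sign on all three edges, and a nonzero \<open>\<delta>\<close> would require \<open>a\<close> or \<open>b\<close> to have positive
  weight on two edges at once in order to make the integers \<open>k i\<close> sum to zero.  With \<open>\<delta> = 0\<close> all
  three coordinates are integers, and the fractional part \<open>\<theta>\<close> can only be compensated by a point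
  on the edge \<open>e\<close> itself.
\<close>

lemma points_on_edge_of_period_vector:
  assumes e: "e \<in> {1, 2 :: nat}" and l: "\<And>i. i \<le> 2 \<Longrightarrow> 0 < l i"
    and \<theta>: "0 < \<theta>" "\<theta> < 1"
    and a: "a \<in> points (theta_graph l)" and b: "b \<in> points (theta_graph l)"
    and per: "period_vector l
      (\<lambda>i. theta_weight l i a - theta_weight l i b - (if i = e then \<theta> else 0))"
  shows "(a = V1 \<or> (\<exists>t. a = Inner e t)) \<and> (b = V2 \<or> (\<exists>t. b = Inner e t))"
proof -
  obtain \<delta> and k :: "nat \<Rightarrow> int" where k: "k 0 + k 1 + k 2 = (0 :: int)"
    and eq': "\<forall>i\<le>2. theta_weight l i a - theta_weight l i b - (if i = e then \<theta> else 0) =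
      \<delta> / l i + k i"
    using per unfolding period_vector_def by blast
  then have eq: "theta_weight l i a - theta_weight l i b =
      \<delta> / l i + k i + (if i = e then \<theta> else 0)" if "i \<le> 2" for i
    using that by (metis diff_add_cancel)
  define x where "x i = \<delta> / l i" for i
  define \<alpha> \<beta> where "\<alpha> i = theta_weight l i a" and "\<beta> i = theta_weight l i b" for i
  obtain e' where idx: "e' \<le> 2" "e \<le> 2" "e \<noteq> 0" "e' \<noteq> 0" "e \<noteq> e'"
      and e_e': "e = 1 \<and> e' = 2 \<or> e = 2 \<and> e' = 1"
    using e that[of 1] that[of 2] by auto
  have weight: "p = V1 \<or> p = V2 \<or> (\<exists>i t. p = Inner i t \<and> i \<le> 2 \<and>
     0 < theta_weight l i p \<and> theta_weight l i p < 1)" if "p \<in> points (theta_graph l)" for p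
  proof -
    have "0 < t / l i \<and> t / l i < 1" if "i \<le> 2" "0 < t" "t < l i" for i t
      using that l[OF that(1)] by simp
    then show ?thesis using theta_graph_points[OF that] unfolding theta_weight_def by fastforce
  qed
  have bounds: "0 \<le> theta_weight l i p \<and> theta_weight l i p \<le> 1"
    if "p \<in> points (theta_graph l)" for i p
    using weight[OF that] by (force simp: theta_weight_def)
  note bounds = bounds[OF a, folded \<alpha>_def] bounds[OF b, folded \<beta>_def]
  have single: "theta_weight l i p = 0 \<or> theta_weight l j p = 0" if "i \<noteq> j" for i j p
    using that by (auto simp: theta_weight_def split: theta_point.splits)
  note single = single[of _ _ a, folded \<alpha>_def] single[of _ _ b, folded \<beta>_def]
  have k: "k 0 + k e + k e' = 0"
    using k e_e' by auto
  have eq0: "k 0 = \<alpha> 0 - \<beta> 0 - x 0" and eqe: "k e = \<alpha> e - \<beta> e - x e - \<theta>"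
    and eqe': "k e' = \<alpha> e' - \<beta> e' - x e'"
    using eq[of 0] eq[of e] eq[of e'] idx by (simp_all add: x_def \<alpha>_def \<beta>_def)
  \<comment> \<open>The values of the rational function at \<open>V1\<close> and \<open>V2\<close> agree.\<close>
  have "\<delta> = 0"
  proof (rule ccontr)
    assume "\<delta> \<noteq> 0"
    then consider "x 0 > 0" "x e > 0" "x e' > 0" | "x 0 < 0" "x e < 0" "x e' < 0"
      using l[of 0] l[of e] l[of e'] idx by (cases "\<delta> > 0") (auto simp: x_def divide_neg_pos)
    then show False
    proof cases
      case 1
      then have "real_of_int (k 0) < 1" "real_of_int (k e) < 1" "real_of_int (k e') < 1"
        using eq0 eqe eqe' bounds(1)[of 0] bounds(1)[of e] bounds(1)[of e']
          bounds(2)[of 0] bounds(2)[of e] bounds(2)[of e'] \<theta> by linarith+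
      then have "k 0 \<le> 0" "k e \<le> 0" "k e' \<le> 0" by simp_all
      then have "k 0 = 0" "k e = 0" "k e' = 0" using k by linarith+
      then show False
        using 1 eq0 eqe eqe' bounds(2)[of 0] bounds(2)[of e] bounds(2)[of e'] \<theta>
          single(1)[of 0 e] idx by auto
    next
      case 2
      then have "real_of_int (k 0) > - 1" "real_of_int (k e) > - 2" "real_of_int (k e') > - 1"
        using eq0 eqe eqe' bounds(1)[of 0] bounds(1)[of e] bounds(1)[of e']
          bounds(2)[of 0] bounds(2)[of e] bounds(2)[of e'] \<theta> by linarith+
      then have ge: "k 0 \<ge> 0" "k e \<ge> - 1" "k e' \<ge> 0" by linarith+
      then consider "k 0 = 0" "k e' = 0" | "k e = - 1" "k 0 = 0" | "k e = - 1" "k e' = 0"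
        using k by linarith
      then show False
      proof cases
        case 1
        then show False
          using 2 eq0 eqe' bounds(1)[of 0] bounds(1)[of e'] single(2)[of 0 e'] idx by auto
      next
        case 3: 2
        then show False
          using 2 eq0 eqe \<theta> bounds(1)[of 0] bounds(1)[of e] single(2)[of 0 e] idx by auto
      next
        case 3
        then show False
          using 2 eqe eqe' \<theta> bounds(1)[of e] bounds(1)[of e'] single(2)[of e e'] idx by auto
      qed
    qed
  qed
  then have x: "x i = 0" for i by (simp add: x_def)
  show ?thesis
  proof -
    have int: "real_of_int (k i) = \<alpha> i - \<beta> i - (if i = e then \<theta> else 0)" if "i \<le> 2" for i
      using eq[OF that] x[of i] by (simp add: x_def \<alpha>_def \<beta>_def)
    \<comment> \<open>Something on the edge \<open>e\<close> must cancel the non-integer \<open>\<theta>\<close>.\<close>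
    have off_e: "\<not> (\<alpha> e = 0 \<and> \<beta> e = 0)"
    proof
      assume "\<alpha> e = 0 \<and> \<beta> e = 0"
      then have "- 1 < real_of_int (k e)" "real_of_int (k e) < 0"
        using int[of e] idx \<theta> by auto
      then have "- 1 < k e" "k e < 0" by linarith+
      then show False by simp
    qed
    \<comment> \<open>A fractional weight on another edge forces both points onto that edge, so that
      none is left for \<open>e\<close>.\<close>
    have no_inner_a: "j = e" if "a = Inner j t" "j \<le> 2" "0 < \<alpha> j" "\<alpha> j < 1" for j t
    proof (rule ccontr)
      assume "j \<noteq> e"
      then have "real_of_int (k j) = \<alpha> j - \<beta> j" using int that by simp
      then have "\<beta> j \<noteq> 0"
        using that by (metis diff_zero of_int_0_less_iff of_int_less_1_iff int_one_le_iff_zero_less not_le)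
      then show False
        using single(1)[of j e] single(2)[of j e] that \<open>j \<noteq> e\<close> off_e by auto
    qed
    have no_inner_b: "j = e" if "b = Inner j t" "j \<le> 2" "0 < \<beta> j" "\<beta> j < 1" for j t
    proof (rule ccontr)
      assume "j \<noteq> e"
      then have "real_of_int (k j) = \<alpha> j - \<beta> j" using int that by simp
      then have "\<alpha> j \<noteq> 0"
        using that by (metis diff_0 of_int_minus add.inverse_inverse of_int_0_less_iff of_int_less_1_iff int_one_le_iff_zero_less not_le)
      then show False
        using single(1)[of j e] single(2)[of j e] that \<open>j \<noteq> e\<close> off_e by auto
    qed
    \<comment> \<open>At the vertices the coordinates may be integral; there the sum of the \<open>k i\<close> decides.\<close>
    have "a \<noteq> V2"
    proof
      assume "a = V2"
      then have "real_of_int (k 0) \<le> 0" "real_of_int (k e) < 0" "real_of_int (k e') \<le> 0"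
        using int[of 0] int[of e] int[of e'] bounds(2)[of 0] bounds(2)[of e] bounds(2)[of e'] idx \<theta>
        by (auto simp: \<alpha>_def theta_weight_def)
      then have "k 0 \<le> 0" "k e < 0" "k e' \<le> 0" by simp_all
      then show False using k by linarith
    qed
    moreover have "b \<noteq> V1"
    proof
      assume "b = V1"
      then have "\<beta> 0 = 1" "\<beta> e = 0" "\<beta> e' = 0" using idx by (auto simp: \<beta>_def theta_weight_def)
      then have "real_of_int (k 0) = \<alpha> 0 - 1" "real_of_int (k e) = \<alpha> e - \<theta>"
        "real_of_int (k e') = \<alpha> e'"
        using int[of 0] int[of e] int[of e'] idx by auto
      moreover from this have "real_of_int (k 0) + real_of_int (k e) + real_of_int (k e') = 0"
        using k by (metis of_int_0 of_int_add)
      ultimately have sum: "\<alpha> 0 + \<alpha> e + \<alpha> e' = 1 + \<theta>" by linarith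
      then show False
        using single(1)[of 0 e] single(1)[of 0 e'] single(1)[of e e'] idx \<theta>
          bounds(1)[of 0] bounds(1)[of e] bounds(1)[of e'] by auto
    qed
    ultimately show ?thesis
      using weight[OF a] weight[OF b] no_inner_a no_inner_b by (auto simp: \<alpha>_def \<beta>_def)
  qed
qed


text \<open>
  If \<open>s = 1\<close>, the preceding lemma applies directly for \<open>j = 1\<close>.  The point \<open>q 2\<close> is nearer to
  \<open>V2\<close> and has weight \<open>(1 - \<theta>2) / 2\<close>, so for \<open>j = 2\<close> the lemma applies to the negated vector,
  which exchanges the roles of \<open>a\<close> and \<open>b\<close> and hence of the two vertices.  If \<open>s = - 1\<close>,
  the signs are reversed in both cases.  So \<open>p 0\<close> is confined to the
  edge \<open>1\<close> without one of its ends and to the edge \<open>2\<close> without the other end.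
\<close>

lemma no_common_residual_point:
  fixes s :: int and p :: "nat \<Rightarrow> theta_point"
  assumes l: "\<And>i. i \<le> 2 \<Longrightarrow> 0 < l i"
    and q0: "q 0 = Inner 0 (l 0 / 2)"
    and q1: "q 1 = Inner 1 t1" "0 < t1" "t1 < l 1 / 2"
    and q2: "q 2 = Inner 2 t2" "l 2 / 2 < t2" "t2 < l 2"
    and s: "s = 1 \<or> s = - 1"
    and p: "\<And>j. j \<le> 2 \<Longrightarrow> p j \<in> points (theta_graph l)"
    and per: "\<And>j. j \<le> 2 \<Longrightarrow>
      period_vector l (\<lambda>i. theta_weight l i (p j) + 2 * s * theta_weight l i (q j) - C i)"
  shows False
proof -
  let ?W = "theta_weight l"
  define \<theta>1 \<theta>2 where "\<theta>1 = 1 - 2 * t1 / l 1" and "\<theta>2 = 2 * t2 / l 2 - 1"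
  have \<theta>: "0 < \<theta>1" "\<theta>1 < 1" "0 < \<theta>2" "\<theta>2 < 1"
    using l[of 1] l[of 2] q1 q2 by (simp_all add: \<theta>1_def \<theta>2_def field_simps)
  have W0: "2 * ?W i (q 0) = (if i = 0 then 1 else 0)" for i
    using l[of 0] by (simp add: theta_weight_def q0)
  have W1: "2 * ?W i (q 1) = (if i = 1 then 1 + \<theta>1 else 0)" for i
    unfolding theta_weight_def q1(1) \<theta>1_def by simp
  have W2: "2 * ?W i (q 2) = (if i = 2 then 1 - \<theta>2 else 0)" for i
    by (simp add: theta_weight_def q2 \<theta>2_def)
  have diff: "period_vector l (\<lambda>i. ?W i (p 0) - ?W i (p j) +
      s * (2 * ?W i (q 0)) - s * (2 * ?W i (q j)) + m i)"
    if "j \<le> 2" and "m 0 + m 1 + m 2 = 0" for j and m :: "nat \<Rightarrow> int"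
    by (rule period_vector_cong[OF period_vector_add[OF period_vector_add[OF per[of 0]
        period_vector_minus[OF per[OF that(1)]]] period_vector_of_int[OF that(2)]]])
      (simp_all add: algebra_simps)
  \<comment> \<open>These periods remove the integral parts of the weights of \<open>2 * q 0 - 2 * q j\<close>.\<close>
  let ?m1 = "\<lambda>i :: nat. if i = 1 then s else if i = 0 then - s else 0"
  let ?m2 = "\<lambda>i :: nat. if i = 2 then s else if i = 0 then - s else 0"
  have d1: "period_vector l (\<lambda>i. ?W i (p 0) - ?W i (p 1) - s * (if i = 1 then \<theta>1 else 0))"
    by (rule period_vector_cong[OF diff[of 1 ?m1]]) (auto simp only: W0 W1, auto simp: algebra_simps)
  have d2: "period_vector l (\<lambda>i. ?W i (p 0) - ?W i (p 2) + s * (if i = 2 then \<theta>2 else 0))"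
    by (rule period_vector_cong[OF diff[of 2 ?m2]]) (auto simp only: W0 W2, auto simp: algebra_simps)
  from s show False
  proof
    assume s: "s = 1"
    have "(p 0 = V1 \<or> (\<exists>t. p 0 = Inner 1 t)) \<and> (p 1 = V2 \<or> (\<exists>t. p 1 = Inner 1 t))"
      by (rule points_on_edge_of_period_vector[OF _ l \<theta>(1,2) p p period_vector_cong[OF d1]])
        (simp_all add: s)
    moreover have "(p 2 = V1 \<or> (\<exists>t. p 2 = Inner 2 t)) \<and> (p 0 = V2 \<or> (\<exists>t. p 0 = Inner 2 t))"
      by (rule points_on_edge_of_period_vector[OF _ l \<theta>(3,4) p p
            period_vector_cong[OF period_vector_minus[OF d2]]])
        (simp_all add: s)
    ultimately show False by auto
  next
    assume s: "s = - 1"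
    have "(p 1 = V1 \<or> (\<exists>t. p 1 = Inner 1 t)) \<and> (p 0 = V2 \<or> (\<exists>t. p 0 = Inner 1 t))"
      by (rule points_on_edge_of_period_vector[OF _ l \<theta>(1,2) p p
            period_vector_cong[OF period_vector_minus[OF d1]]])
        (simp_all add: s)
    moreover have "(p 0 = V1 \<or> (\<exists>t. p 0 = Inner 2 t)) \<and> (p 2 = V2 \<or> (\<exists>t. p 2 = Inner 2 t))"
      by (rule points_on_edge_of_period_vector[OF _ l \<theta>(3,4) p p period_vector_cong[OF d2]])
        (simp_all add: s)
    ultimately show False by auto
  qed
qed

section \<open>Pushing a divisor down to the theta graph\<close>

text \<open>
  The divisor that is left over has degree \<open>(2 * r + 1) - r - r = 1\<close>: \<open>r\<close> points are removed from
  the loops in \<open>A\<close>, and \<open>r\<close> points of the remaining effective divisor are forced into them.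
\<close>

lemma residual_point:
  fixes l c :: "nat \<Rightarrow> real" and q :: "nat \<Rightarrow> theta_point" and n r :: nat
  defines "H \<equiv> attach_loops (theta_graph l) {..n} q c"
  assumes l: "\<And>i. i \<le> 2 \<Longrightarrow> 0 < l i" and c: "\<And>i. i \<le> n \<Longrightarrow> 0 < c i"
    and q: "\<And>i. i \<le> n \<Longrightarrow> q i \<in> points (theta_graph l)"
    and D: "div_degree D = 2 * int r + 1" "div_rank H D = int r"
    and A: "A \<subseteq> {..n}" "card A = r"
  shows "\<exists>p \<in> points (theta_graph l). period_vector l
    (\<lambda>i. theta_weight l i p + 2 * (\<Sum>j\<in>A. theta_weight l i (q j)) -
      pairing (theta_weight l i \<circ> base_point q) D)"
proof -
  have G: "is_metric_graph (theta_graph l)" using l by (rule is_metric_graph_theta_graph)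
  then have fin: "finite (edges (theta_graph l))" by (simp add: is_metric_graph_def)
  have H: "is_metric_graph H"
    unfolding H_def using G q c by (intro is_metric_graph_attach_loops) auto
  obtain x y R where R: "divisor H R" "effective R"
    and eq: "lin_equiv H (loop_divisor A y + R) (D - loop_divisor A x)"
    using rank_forces_loop_points[OF H[unfolded H_def] _ fin _ D(2)[unfolded H_def] A] c
    unfolding H_def by (metis atMost_iff finite_atMost)
  have "div_degree (R - (- loop_divisor A y)) = div_degree (D - loop_divisor A x)"
    using lin_equiv_div_degree_eq[OF H eq] by (simp add: add.commute)
  moreover have "div_degree (- loop_divisor A y :: theta_point + nat \<times> real \<Rightarrow>\<^sub>0 int) = - int r"
    using div_degree_diff[of 0 "loop_divisor A y :: theta_point + nat \<times> real \<Rightarrow>\<^sub>0 int"]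
    by (simp add: div_degree_loop_divisor A div_degree_def[of 0])
  ultimately have "div_degree R = 1"
    using D(1) unfolding div_degree_diff div_degree_loop_divisor A(2) by linarith
  then obtain z where z: "R = Poly_Mapping.single z 1" using R(2) effective_degree_1 by blast
  let ?p = "base_point q z"
  have "z \<in> points H" using R(1) by (simp add: divisor_def z)
  then have p: "?p \<in> points (theta_graph l)"
    unfolding H_def using q by (intro base_point_in_points) auto
  obtain f where f: "rational_function (theta_graph l) f"
    "\<And>\<phi>. pairing (\<phi> \<circ> base_point q) (loop_divisor A y + R) - pairing (\<phi> \<circ> base_point q) (D - loop_divisor A x) =
       (\<Sum>e\<in>edges (theta_graph l). edge_pairing (len (theta_graph l) e)
          (f \<circ> chart (theta_graph l) e) (\<phi> \<circ> chart (theta_graph l) e))"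
    using base_point_pairing[OF H[unfolded H_def] _ fin eq[unfolded H_def]] by blast
  have "period_vector l (\<lambda>i. theta_weight l i ?p + 2 * (\<Sum>j\<in>A. theta_weight l i (q j)) -
      pairing (theta_weight l i \<circ> base_point q) D)"
  proof (rule period_vector_cong)
    show "period_vector l (\<lambda>i. \<Sum>e\<in>edges (theta_graph l). edge_pairing (len (theta_graph l) e)
      (f \<circ> chart (theta_graph l) e) (theta_weight l i \<circ> chart (theta_graph l) e))"
      using l f(1) by (rule theta_weight_pairing)
  next
    fix i :: nat
    show "theta_weight l i ?p + 2 * (\<Sum>j\<in>A. theta_weight l i (q j)) -
      pairing (theta_weight l i \<circ> base_point q) D =
      (\<Sum>e\<in>edges (theta_graph l). edge_pairing (len (theta_graph l) e)
      (f \<circ> chart (theta_graph l) e) (theta_weight l i \<circ> chart (theta_graph l) e))"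
      unfolding f(2)[symmetric]
      by (simp add: pairing_add pairing_diff pairing_loop_divisor z pairing_single base_point_def)
  qed
  with p show ?thesis by blast
qed

theorem proposition1:
  fixes n r :: nat
    and l c :: "nat \<Rightarrow> real"
    and q :: "nat \<Rightarrow> theta_point"
  defines "G0 \<equiv> theta_graph l"
  defines "G \<equiv> attach_loops G0 {..n} q c"
  assumes "n \<ge> 2"
    and "\<And>i. i \<le> 2 \<Longrightarrow> 0 < l i" and "inj_on l {..2}"
    and "\<And>i. i \<le> n \<Longrightarrow> 0 < c i"
    and "q 0 = midpt G0 0"
    and "q 1 \<in> chart G0 1 ` {0<..<l 1 / 2}"
    and "q 2 \<in> chart G0 2 ` {l 2 / 2<..<l 2}"
    and "\<And>i. 3 \<le> i \<Longrightarrow> i \<le> n \<Longrightarrow> q i \<in> points G0"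
    and "distinct ([V1, V2, midpt G0 0, midpt G0 1, midpt G0 2] @ map q [1..<Suc n])"
    and "1 \<le> r" and "r \<le> n"
  shows "\<not> (\<exists>D. divisor G D \<and> div_degree D = 2 * int r + 1 \<and> div_rank G D = int r)"
proof
  assume "\<exists>D. divisor G D \<and> div_degree D = 2 * int r + 1 \<and> div_rank G D = int r"
  then obtain D where D: "div_degree D = 2 * int r + 1" "div_rank G D = int r" by blast
  note l = assms(4) and c = assms(6)
  have G0: "edges G0 = {..2}" "len G0 = l"
    "\<And>e t. chart G0 e t = (if t = 0 then V1 else if t = l e then V2 else Inner e t)"
    by (simp_all add: G0_def theta_graph_def)
  have chart_point: "chart G0 e t \<in> points G0" if "e \<le> 2" "0 \<le> t" "t \<le> l e" for e t
    using that unfolding points_def params_def G0(1,2) by force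
  have q0: "q 0 = Inner 0 (l 0 / 2)"
    using l[of 0] by (simp add: assms(7) midpt_def G0)
  obtain t1 where q1: "q 1 = Inner 1 t1" "0 < t1" "t1 < l 1 / 2" "q 1 = chart G0 1 t1"
    using assms(8) by (auto simp: G0)
  obtain t2 where q2: "q 2 = Inner 2 t2" "l 2 / 2 < t2" "t2 < l 2" "q 2 = chart G0 2 t2"
    using assms(9) l[of 2] by (auto simp: G0)
  have q: "q i \<in> points G0" if "i \<le> n" for i
  proof -
    consider "i = 0" | "i = 1" | "i = 2" | "3 \<le> i" by linarith
    then show ?thesis
    proof cases
      case 1
      then show ?thesis
        using chart_point[of 0 "l 0 / 2"] l[of 0] assms(7) by (simp add: midpt_def G0(2))
    next
      case 2
      then show ?thesis using chart_point[of 1 t1] q1 by simp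
    next
      case 3
      then show ?thesis using chart_point[of 2 t2] q2 l[of 2] by simp
    next
      case 4
      then show ?thesis using assms(10) that by blast
    qed
  qed
  define C where "C i = pairing (theta_weight l i \<circ> base_point q) D" for i
  have residual: "\<exists>p \<in> points G0. period_vector l
      (\<lambda>i. theta_weight l i p + 2 * (\<Sum>j\<in>A. theta_weight l i (q j)) - C i)"
    if "A \<subseteq> {..n}" "card A = r" for A
    unfolding C_def G0_def
    using l c q[unfolded G0_def] D(1) D(2)[unfolded G_def G0_def] that by (rule residual_point)
  \<comment> \<open>It suffices to find points \<open>p j\<close> for which \<open>p j + 2 * s * q j\<close> has the same class
    for all \<open>j \<le> 2\<close>.\<close>
  have contra: False
    if s: "s = 1 \<or> s = - 1" and ex: "\<And>j. j \<le> 2 \<Longrightarrow> \<exists>p \<in> points G0.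
      period_vector l (\<lambda>i. theta_weight l i p + 2 * s * theta_weight l i (q j) - C' i)"
    for s :: int and C' :: "nat \<Rightarrow> real"
  proof -
    have "\<exists>p. \<forall>j\<in>{..2}. p j \<in> points G0 \<and>
        period_vector l (\<lambda>i. theta_weight l i (p j) + 2 * s * theta_weight l i (q j) - C' i)"
      using ex by (intro bchoice) (auto simp: Bex_def)
    then obtain p where p: "\<forall>j\<in>{..2}. p j \<in> points G0 \<and>
        period_vector l (\<lambda>i. theta_weight l i (p j) + 2 * s * theta_weight l i (q j) - C' i)"
      ..
    show False
      by (rule no_common_residual_point[where p = p and C = C', OF l q0 q1(1-3) q2(1-3) s])
        (use p in \<open>simp_all add: G0_def\<close>)
  qed
  show False
  proof (cases "r = 1")
    case True
    have "\<exists>p \<in> points G0.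
        period_vector l (\<lambda>i. theta_weight l i p + of_int (2 * 1) * theta_weight l i (q j) - C i)"
      if "j \<le> 2" for j
      using residual[of "{j}"] True assms(3) that by simp
    from contra[OF _ this] show False by simp
  next
    case False
    then have r: "2 \<le> r" using assms(12) by simp
    \<comment> \<open>Compare the sets \<open>{..r} - {j}\<close>, all of size \<open>r\<close> for \<open>j \<le> 2\<close> because
      \<open>r \<ge> 2\<close>: the points in the sum over \<open>{..r}\<close> are common to them, up to \<open>- 2 * q j\<close>.\<close>
    define C' where "C' i = C i - 2 * (\<Sum>j\<le>r. theta_weight l i (q j))" for i
    have "\<exists>p \<in> points G0.
        period_vector l (\<lambda>i. theta_weight l i p + of_int (2 * - 1) * theta_weight l i (q j) - C' i)"
      if j: "j \<le> 2" for j
    proof -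
      have sum: "(\<Sum>j\<in>{..r} - {j}. theta_weight l i (q j)) =
          (\<Sum>j\<le>r. theta_weight l i (q j)) - theta_weight l i (q j)" for i
        using j r by (subst sum_diff1) auto
      have "{..r} - {j} \<subseteq> {..n}" "card ({..r} - {j}) = r"
        using j r assms(13) by auto
      from residual[OF this] show ?thesis
        by (simp add: sum C'_def algebra_simps)
    qed
    from contra[OF _ this] show False by simp
  qed
qed

end
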